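(* Let $(\mathfrak g,\varphi_i,\xi_i,\eta_i)$ be an almost $3$-contact Lie algebra with abelian structure. Then the vector $\mathcal Z\in\mathfrak h$ satisfies $\psi(\mathcal Z)=0$. In particular, $[\xi,\mathcal Z]=0$ for all $\xi\in\mathfrak v$.
   Context: An almost contact structure on a real Lie algebra $\mathfrak g$ is a triple $(\varphi,\xi,\eta)$, $\varphi\in\mathrm{End}(\mathfrak g)$, $\xi\in\mathfrak g$, $\eta\in\mathfrak g^*$, with $\varphi^2=-I+\eta\otimes\xi$ and $\eta(\xi)=1$. It is abelian if $\mathrm{ad}_\xi\circ\varphi=\varphi\circ\mathrm{ad}_\xi$ and $[\varphi X,\varphi Y]=[X,Y]$ for all $X,Y\in\operatorname{Ker}\eta$. An almost $3$-contact Lie algebra is a real Lie algebra $\mathfrak g$ of dimension $4n+3$ with three almost contact structures $(\varphi_i,\xi_i,\eta_i)$, $i=1,2,3$, such that for every even permutation $(i,j,k)$ of $(1,2,3)$: $\varphi_k=\varphi_i\varphi_j-\eta_j\otimes\xi_i=-\varphi_j\varphi_i+\eta_i\otimes\xi_j$, $\xi_k=\varphi_i\xi_j=-\varphi_j\xi_i$, $\eta_k=\eta_i\circ\varphi_j=-\eta_j\circ\varphi_i$. It is abelian if each $(\varphi_i,\xi_i,\eta_i)$ is abelian. Set $\mathfrak h=\bigcap_i\operatorname{Ker}\eta_i$ and $\mathfrak v=\langle\xi_1,\xi_2,\xi_3\rangle$. For an abelian structure the following are well defined: $\mathcal Z:=\varphi_i([\xi_j,\xi_k])\in\mathfrak h$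 (independent of the even permutation $(i,j,k)$ of $(1,2,3)$) and $\psi:=(\mathrm{ad}_{\xi_i}\circ\varphi_i)|_{\mathfrak h}=(\varphi_i\circ\mathrm{ad}_{\xi_i})|_{\mathfrak h}:\mathfrak h\to\mathfrak h$ (independent of $i$). *)

theory Defs
  imports "HOL-Analysis.Linear_Algebra"
begin

locale real_lie_algebra =
  fixes br :: "'a::real_vector \<Rightarrow> 'a \<Rightarrow> 'a"
  assumes bilinear_br: "bilinear br"
    and br_self: "br x x = 0"
    and jacobi: "br x (br y z) + br y (br z x) + br z (br x y) = 0"

definition almost_contact ::
    "('a::real_vector \<Rightarrow> 'a) \<Rightarrow> 'a \<Rightarrow> ('a \<Rightarrow> real) \<Rightarrow> bool" where
  "almost_contact \<phi> \<xi> \<eta> \<longleftrightarrow>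
     linear \<phi> \<and> linear \<eta> \<and> (\<forall>X. \<phi> (\<phi> X) = - X + \<eta> X *\<^sub>R \<xi>) \<and> \<eta> \<xi> = 1"

definition abelian_contact ::
    "('a::real_vector \<Rightarrow> 'a \<Rightarrow> 'a) \<Rightarrow> ('a \<Rightarrow> 'a) \<Rightarrow> 'a \<Rightarrow> ('a \<Rightarrow> real) \<Rightarrow> bool" where
  "abelian_contact br \<phi> \<xi> \<eta> \<longleftrightarrow>
     br \<xi> \<circ> \<phi> = \<phi> \<circ> br \<xi> \<and>
     (\<forall>X Y. \<eta> X = 0 \<longrightarrow> \<eta> Y = 0 \<longrightarrow> br (\<phi> X) (\<phi> Y) = br X Y)"

definition even_perms :: "(nat \<times> nat \<times> nat) set" where
  "even_perms = {(1, 2, 3), (2, 3, 1), (3, 1, 2)}"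

text \<open>The three structures are families indexed by \<open>nat\<close>; only the indices 1, 2, 3 matter.
  The dimension requirement forces finite dimension, since \<^const>\<open>dim\<close> is 0 on
  infinite-dimensional spaces.\<close>

locale almost_3_contact_lie_algebra = real_lie_algebra br
  for br :: "'a::real_vector \<Rightarrow> 'a \<Rightarrow> 'a" +
  fixes \<phi> :: "nat \<Rightarrow> 'a \<Rightarrow> 'a" and \<xi> :: "nat \<Rightarrow> 'a" and \<eta> :: "nat \<Rightarrow> 'a \<Rightarrow> real"
  assumes dim_4n3: "\<exists>n. dim (UNIV :: 'a set) = 4 * n + 3"
    and contact: "i \<in> {1, 2, 3} \<Longrightarrow> almost_contact (\<phi> i) (\<xi> i) (\<eta> i)"
    and phi_1: "(i, j, k) \<in> even_perms \<Longrightarrow> \<phi> k X = \<phi> i (\<phi> j X) - \<eta> j X *\<^sub>R \<xi> i"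
    and phi_2: "(i, j, k) \<in> even_perms \<Longrightarrow> \<phi> k X = - \<phi> j (\<phi> i X) + \<eta> i X *\<^sub>R \<xi> j"
    and xi_1: "(i, j, k) \<in> even_perms \<Longrightarrow> \<xi> k = \<phi> i (\<xi> j)"
    and xi_2: "(i, j, k) \<in> even_perms \<Longrightarrow> \<xi> k = - \<phi> j (\<xi> i)"
    and eta_1: "(i, j, k) \<in> even_perms \<Longrightarrow> \<eta> k X = \<eta> i (\<phi> j X)"
    and eta_2: "(i, j, k) \<in> even_perms \<Longrightarrow> \<eta> k X = - \<eta> j (\<phi> i X)"

locale abelian_almost_3_contact_lie_algebra = almost_3_contact_lie_algebra +
  assumes abelian: "i \<in> {1, 2, 3} \<Longrightarrow> abelian_contact br (\<phi> i) (\<xi> i) (\<eta> i)"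

definition horizontal :: "(nat \<Rightarrow> 'a::real_vector \<Rightarrow> real) \<Rightarrow> 'a set" where
  "horizontal \<eta> = (\<Inter>i\<in>{1, 2, 3}. {X. \<eta> i X = 0})"

definition vertical :: "(nat \<Rightarrow> 'a::real_vector) \<Rightarrow> 'a set" where
  "vertical \<xi> = span {\<xi> 1, \<xi> 2, \<xi> 3}"

text \<open>The next two definitions fix one choice of indices; for abelian structures the choice is
  immaterial by \<open>Z_vec_eq\<close> and \<open>psi_eq\<close> below. Only the values of \<open>psi\<close> on
  \<^const>\<open>horizontal\<close> are meaningful.\<close>

definition Z_vec ::
    "('a::real_vector \<Rightarrow> 'a \<Rightarrow> 'a) \<Rightarrow> (nat \<Rightarrow> 'a \<Rightarrow> 'a) \<Rightarrow> (nat \<Rightarrow> 'a) \<Rightarrow> 'a" where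
  "Z_vec br \<phi> \<xi> = \<phi> 1 (br (\<xi> 2) (\<xi> 3))"

definition psi ::
    "('a::real_vector \<Rightarrow> 'a \<Rightarrow> 'a) \<Rightarrow> (nat \<Rightarrow> 'a \<Rightarrow> 'a) \<Rightarrow> (nat \<Rightarrow> 'a) \<Rightarrow> 'a \<Rightarrow> 'a" where
  "psi br \<phi> \<xi> X = br (\<xi> 1) (\<phi> 1 X)"

context abelian_almost_3_contact_lie_algebra
begin

lemma br_skew: "br x y = - br y x"
proof -
  have "br (x + y) (x + y) = br x x + br x y + (br y x + br y y)"
    using bilinear_br by (simp add: bilinear_ladd bilinear_radd)
  then show ?thesis by (simp add: br_self add_eq_0_iff)
qed

lemma perm_mem: "(i, j, k) \<in> even_perms \<Longrightarrow> i \<in> {1,2,3} \<and> j \<in> {1,2,3} \<and> k \<in> {1,2,3}"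
  by (auto simp: even_perms_def)

lemma perm_rot: "(i, j, k) \<in> even_perms \<Longrightarrow> (j, k, i) \<in> even_perms"
  by (auto simp: even_perms_def)

lemma phi_linear: "i \<in> {1,2,3} \<Longrightarrow> linear (\<phi> i)"
  and eta_linear: "i \<in> {1,2,3} \<Longrightarrow> linear (\<eta> i)"
  and phi_sq: "i \<in> {1,2,3} \<Longrightarrow> \<phi> i (\<phi> i X) = - X + \<eta> i X *\<^sub>R \<xi> i"
  and eta_xi: "i \<in> {1,2,3} \<Longrightarrow> \<eta> i (\<xi> i) = 1"
  using contact[of i] by (auto simp: almost_contact_def)

lemma phi_xi: assumes i: "i \<in> {1,2,3}" shows "\<phi> i (\<xi> i) = 0"
proof -
  note lin = phi_linear[OF i] and sq = phi_sq[OF i]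
  have a: "\<phi> i (\<phi> i (\<xi> i)) = 0" using sq[of "\<xi> i"] eta_xi[OF i] by simp
  have "\<phi> i (\<phi> i (\<phi> i (\<xi> i))) = 0" unfolding a by (rule linear_0[OF lin])
  then have e: "\<phi> i (\<xi> i) = \<eta> i (\<phi> i (\<xi> i)) *\<^sub>R \<xi> i"
    using sq[of "\<phi> i (\<xi> i)"] by (simp add: add_eq_0_iff)
  define c where "c = \<eta> i (\<phi> i (\<xi> i))"
  have e': "\<phi> i (\<xi> i) = c *\<^sub>R \<xi> i" using e by (simp add: c_def)
  have "\<xi> i \<noteq> 0" using eta_xi[OF i] linear_0[OF eta_linear[OF i]] by auto
  moreover have "c *\<^sub>R c *\<^sub>R \<xi> i = 0"
    using a linear_scale[OF lin, of c "\<xi> i"] by (simp add: e')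
  ultimately show ?thesis using e' by auto
qed

lemma eta_phi: assumes i: "i \<in> {1,2,3}" shows "\<eta> i (\<phi> i X) = 0"
proof -
  note lin = phi_linear[OF i] and sq = phi_sq[OF i]
  have "\<phi> i (\<phi> i (\<phi> i X)) = \<phi> i (- X) + \<eta> i X *\<^sub>R \<phi> i (\<xi> i)"
    unfolding sq[of X] by (simp only: linear_add[OF lin] linear_scale[OF lin])
  then have "\<phi> i (\<phi> i (\<phi> i X)) = - \<phi> i X"
    by (simp add: phi_xi[OF i] linear_neg[OF lin])
  then have "\<eta> i (\<phi> i X) *\<^sub>R \<xi> i = 0" using sq[of "\<phi> i X"] by simp
  moreover have "\<xi> i \<noteq> 0" using eta_xi[OF i] linear_0[OF eta_linear[OF i]] by auto
  ultimately show ?thesis by simp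
qed

lemma ad_phi: "i \<in> {1,2,3} \<Longrightarrow> br (\<xi> i) (\<phi> i X) = \<phi> i (br (\<xi> i) X)"
  using abelian[of i] by (auto simp: abelian_contact_def fun_eq_iff)

lemma Z_rot:
  assumes p: "(i, j, k) \<in> even_perms"
  shows "\<phi> i (br (\<xi> j) (\<xi> k)) = \<phi> k (br (\<xi> i) (\<xi> j))"
proof -
  have i: "i \<in> {1,2,3}" and j: "j \<in> {1,2,3}" and k: "k \<in> {1,2,3}" using perm_mem[OF p] by auto
  have q: "\<xi> k = - \<phi> j (\<xi> i)" "\<xi> i = \<phi> j (\<xi> k)"
    using xi_2[OF p] xi_1[OF perm_rot[OF p]] by auto
  have "br (\<xi> j) (\<xi> k) = - \<phi> j (br (\<xi> j) (\<xi> i))"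
    using ad_phi[OF j, of "\<xi> i"] q(1) bilinear_rneg[OF bilinear_br] by simp
  also have "\<dots> = \<phi> j (br (\<xi> i) (\<xi> j))"
    using br_skew[of "\<xi> i" "\<xi> j"] linear_neg[OF phi_linear[OF j]] by simp
  finally have 1: "br (\<xi> j) (\<xi> k) = \<phi> j (br (\<xi> i) (\<xi> j))" .
  have "\<eta> j (br (\<xi> j) (\<xi> i)) = 0"
    using ad_phi[OF j, of "\<xi> k"] q(2) eta_phi[OF j] by simp
  then have "\<eta> j (br (\<xi> i) (\<xi> j)) = 0"
    using br_skew[of "\<xi> i" "\<xi> j"] linear_neg[OF eta_linear[OF j]] by simp
  then show ?thesis using phi_1[OF p, of "br (\<xi> i) (\<xi> j)"] 1 by simp
qed

lemma Z_vec_eq: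
  assumes "(i, j, k) \<in> even_perms"
  shows "Z_vec br \<phi> \<xi> = \<phi> i (br (\<xi> j) (\<xi> k))"
  using assms Z_rot[of 1 2 3] Z_rot[of 2 3 1] Z_rot[of 3 1 2]
  by (auto simp: even_perms_def Z_vec_def)

lemma Z_vec_horizontal: "Z_vec br \<phi> \<xi> \<in> horizontal \<eta>"
  unfolding horizontal_def
proof (intro INT_I CollectI)
  fix i :: nat assume i: "i \<in> {1, 2, 3}"
  then obtain j k where p: "(i, j, k) \<in> even_perms" by (auto simp: even_perms_def)
  show "\<eta> i (Z_vec br \<phi> \<xi>) = 0"
    unfolding Z_vec_eq[OF p] by (rule eta_phi[OF i])
qed

lemma psi_rot:
  assumes p: "(i, j, k) \<in> even_perms" and X: "X \<in> horizontal \<eta>"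
  shows "br (\<xi> i) (\<phi> i X) = br (\<xi> j) (\<phi> j X)"
proof -
  have i: "i \<in> {1,2,3}" and j: "j \<in> {1,2,3}" and k: "k \<in> {1,2,3}" using perm_mem[OF p] by auto
  have p2: "(k, i, j) \<in> even_perms" using perm_rot[OF perm_rot[OF p]] .
  have h: "\<eta> i X = 0" "\<eta> j X = 0" using X i j by (auto simp: horizontal_def)
  have "\<eta> k (\<xi> i) = 0" using xi_1[OF perm_rot[OF p]] eta_1[OF p, of "\<xi> i"] 
     eta_2[OF p, of "\<xi> i"] phi_xi[OF i] linear_0[OF eta_linear[OF j]] by simp
  moreover have "\<eta> k (\<phi> i X) = 0" using eta_1[OF p2, of X] h by simp
  ultimately have "br (\<phi> k (\<xi> i)) (\<phi> k (\<phi> i X)) = br (\<xi> i) (\<phi> i X)"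
    using abelian[OF k] by (auto simp: abelian_contact_def)
  moreover have "\<phi> k (\<xi> i) = \<xi> j" using xi_1[OF p2] by simp
  moreover have "\<phi> k (\<phi> i X) = \<phi> j X" using phi_1[OF p2, of X] h by simp
  ultimately show ?thesis by simp
qed

lemma psi_eq:
  assumes "i \<in> {1, 2, 3}" and X: "X \<in> horizontal \<eta>"
  shows "psi br \<phi> \<xi> X = br (\<xi> i) (\<phi> i X)"
    and "psi br \<phi> \<xi> X = \<phi> i (br (\<xi> i) X)"
proof -
  show "psi br \<phi> \<xi> X = br (\<xi> i) (\<phi> i X)"
    using assms(1) psi_rot[OF _ X, of 1 2 3] psi_rot[OF _ X, of 2 3 1]
    by (auto simp: even_perms_def psi_def)
  then show "psi br \<phi> \<xi> X = \<phi> i (br (\<xi> i) X)" using ad_phi[OF assms(1)] by simp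
qed

lemma psi_horizontal:
  assumes X: "X \<in> horizontal \<eta>"
  shows "psi br \<phi> \<xi> X \<in> horizontal \<eta>"
  unfolding horizontal_def
proof (intro INT_I CollectI)
  fix i :: nat assume i: "i \<in> {1, 2, 3}"
  show "\<eta> i (psi br \<phi> \<xi> X) = 0"
    unfolding psi_eq(2)[OF i X] by (rule eta_phi[OF i])
qed

end

end

theory Submission
  imports Defs
begin

text \<open>Since \<open>\<phi>\<^sub>i\<^sup>2 = -I + \<eta>\<^sub>i \<otimes> \<xi>\<^sub>i\<close>, each bracket \<open>[\<xi>\<^sub>j, \<xi>\<^sub>k]\<close> equals \<open>-\<phi>\<^sub>i Z\<close> up to a
  multiple of \<open>\<xi>\<^sub>i\<close>, so \<open>[\<xi>\<^sub>i, [\<xi>\<^sub>j, \<xi>\<^sub>k]] = -\<psi> Z\<close> for every even permutation. The Jacobi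
  identity for the \<open>\<xi>\<^sub>i\<close> then reads \<open>-3 \<psi> Z = 0\<close>. Finally \<open>[\<xi>\<^sub>i, Z] = 0\<close>, because it lies in
  the kernel of \<open>\<phi>\<^sub>i\<close>, and also in its image as \<open>Z\<close> does; these meet trivially.\<close>

context abelian_almost_3_contact_lie_algebra
begin

lemma br_xi_br_xi_xi:
  assumes p: "(i, j, k) \<in> even_perms"
  shows "br (\<xi> i) (br (\<xi> j) (\<xi> k)) = - psi br \<phi> \<xi> (Z_vec br \<phi> \<xi>)"
proof -
  have i: "i \<in> {1, 2, 3}" using perm_mem[OF p] by simp
  let ?W = "br (\<xi> j) (\<xi> k)"
  have "\<phi> i (Z_vec br \<phi> \<xi>) = - ?W + \<eta> i ?W *\<^sub>R \<xi> i"
    unfolding Z_vec_eq[OF p] by (rule phi_sq[OF i])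
  \<comment> \<open>Bracketing with \<open>\<xi> i\<close> kills the \<open>\<xi> i\<close>
    component, by \<open>br_self\<close>.\<close>
  then have "br (\<xi> i) (\<phi> i (Z_vec br \<phi> \<xi>)) = - br (\<xi> i) ?W"
    using bilinear_br by (simp add: bilinear_rsub bilinear_rmul br_self)
  then show ?thesis using psi_eq(1)[OF i Z_vec_horizontal] by simp
qed

lemma psi_Z_vec: "psi br \<phi> \<xi> (Z_vec br \<phi> \<xi>) = 0"
proof -
  let ?P = "psi br \<phi> \<xi> (Z_vec br \<phi> \<xi>)"
  have "- ?P + - ?P + - ?P = 0"
    using jacobi[of "\<xi> 1" "\<xi> 2" "\<xi> 3"] br_xi_br_xi_xi[of 1 2 3] br_xi_br_xi_xi[of 2 3 1]
      br_xi_br_xi_xi[of 3 1 2]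
    by (simp add: even_perms_def)
  \<comment> \<open>As a single real multiple of \<open>?P\<close>, the sum lets the nonzero factor
    be cancelled.\<close>
  moreover have "- ?P + - ?P + - ?P = (- 3) *\<^sub>R ?P"
    using scaleR_left_distrib[of "- 1" "- 1" ?P] scaleR_left_distrib[of "- 2" "- 1" ?P] by simp
  ultimately show ?thesis by simp
qed

lemma br_xi_Z_vec:
  assumes i: "i \<in> {1, 2, 3}"
  shows "br (\<xi> i) (Z_vec br \<phi> \<xi>) = 0"
proof -
  obtain j k where p: "(i, j, k) \<in> even_perms" using i by (auto simp: even_perms_def)
  let ?B = "br (\<xi> i) (Z_vec br \<phi> \<xi>)"
  \<comment> \<open>\<open>ad_phi\<close> pulls \<open>\<phi> i\<close> out of the bracket, so
    \<open>?B\<close> lies in the image of \<open>\<phi> i\<close>, where \<open>\<eta> i\<close>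
    vanishes.\<close>
  have "\<eta> i ?B = 0"
    unfolding Z_vec_eq[OF p] ad_phi[OF i] by (rule eta_phi[OF i])
  moreover have "\<phi> i ?B = 0" using psi_eq(2)[OF i Z_vec_horizontal] psi_Z_vec by simp
  \<comment> \<open>Both terms vanish, so \<open>phi_sq\<close> at \<open>?B\<close> reads
    \<open>0 = - ?B\<close>.\<close>
  ultimately show ?thesis using phi_sq[OF i, of ?B] linear_0[OF phi_linear[OF i]] by simp
qed

lemma br_vertical_Z_vec:
  assumes "V \<in> vertical \<xi>"
  shows "br V (Z_vec br \<phi> \<xi>) = 0"
proof (rule linear_eq_0_on_span[where f = "\<lambda>V. br V (Z_vec br \<phi> \<xi>)"])
  show "linear (\<lambda>V. br V (Z_vec br \<phi> \<xi>))" using bilinear_br by (simp add: bilinear_def)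
  show "V \<in> span {\<xi> 1, \<xi> 2, \<xi> 3}" using assms by (simp add: vertical_def)
qed (use br_xi_Z_vec in auto)

end

theorem proposition4p8:
  fixes br :: "'a::real_vector \<Rightarrow> 'a \<Rightarrow> 'a"
    and \<phi> :: "nat \<Rightarrow> 'a \<Rightarrow> 'a" and \<xi> :: "nat \<Rightarrow> 'a" and \<eta> :: "nat \<Rightarrow> 'a \<Rightarrow> real"
  assumes "abelian_almost_3_contact_lie_algebra br \<phi> \<xi> \<eta>"
  shows "Z_vec br \<phi> \<xi> \<in> horizontal \<eta> \<and> psi br \<phi> \<xi> (Z_vec br \<phi> \<xi>) = 0 \<and>
    (\<forall>V\<in>vertical \<xi>. br V (Z_vec br \<phi> \<xi>) = 0)"
proof -
  interpret abelian_almost_3_contact_lie_algebra br \<phi> \<xi> \<eta> by (rule assms)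
  show ?thesis using Z_vec_horizontal psi_Z_vec br_vertical_Z_vec by blast
qed

end
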